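(* Let $\boldsymbol{p}=\prod_{k=1}^K[\underline p_k,\overline p_k]\subset\mathbb{R}^K$ be a box with $\underline p_k\le\overline p_k$, let $A^{(0)},\dots,A^{(K)}\in\mathbb{R}^{n\times n}$, let $A(p)=A^{(0)}+\sum_{k=1}^K A^{(k)}p_k$, and suppose that the parametric interval matrix $A(\boldsymbol{p})$ is symmetric, i.e. $A(p)$ is a symmetric matrix for every $p\in\boldsymbol{p}$. Then $A(\boldsymbol{p})$ is stable if and only if both of the following hold: (i) $A(p)$ is stable for some (arbitrarily chosen) $p\in\boldsymbol{p}$; (ii) $A(\boldsymbol{p})$ is regular.
   Context: A parametric interval matrix with affine-linear dependencies is a family $A(\boldsymbol{p})=\{A(p)=A^{(0)}+\sum_{k=1}^K A^{(k)}p_k \mid p\in\boldsymbol{p}\}$ of real $n\times n$ matrices, where $\boldsymbol{p}$ is a product of compact intervals. A real square matrix is stable (Hurwitz) if every eigenvalue has strictly negative real part. $A(\boldsymbol{p})$ is stable if $A(p)$ is stable for each $p\in\boldsymbol{p}$. $A(\boldsymbol{p})$ is regular if $A(p)$ is nonsingular for each $p\in\boldsymbol{p}$. *)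

theory Defs
  imports "HOL-Analysis.Analysis"
begin

definition matrix_eigenvalue :: "'a::field ^ 'n ^ 'n \<Rightarrow> 'a \<Rightarrow> bool" where
  "matrix_eigenvalue M c \<longleftrightarrow> (\<exists>v. v \<noteq> 0 \<and> M *v v = c *s v)"

definition complex_matrix :: "real ^ 'n ^ 'm \<Rightarrow> complex ^ 'n ^ 'm" where
  "complex_matrix M = (\<chi> i j. complex_of_real (M $ i $ j))"

text \<open>The eigenvalues of a real matrix are its complex eigenvalues, hence the passage to
  \<^const>\<open>complex_matrix\<close>.\<close>

definition stable_matrix :: "real ^ 'n ^ 'n \<Rightarrow> bool" where
  "stable_matrix M \<longleftrightarrow> (\<forall>c. matrix_eigenvalue (complex_matrix M) c \<longrightarrow> Re c < 0)"

definition symmetric_matrix :: "real ^ 'n ^ 'n \<Rightarrow> bool" where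
  "symmetric_matrix M \<longleftrightarrow> transpose M = M"

definition param_matrix ::
    "real ^ 'n ^ 'n \<Rightarrow> ('k::finite \<Rightarrow> real ^ 'n ^ 'n) \<Rightarrow> real ^ 'k \<Rightarrow> real ^ 'n ^ 'n" where
  "param_matrix A0 A p = A0 + (\<Sum>k\<in>UNIV. (p $ k) *\<^sub>R A k)"

definition param_interval_matrix ::
    "real ^ 'n ^ 'n \<Rightarrow> ('k::finite \<Rightarrow> real ^ 'n ^ 'n) \<Rightarrow> (real ^ 'k) set
      \<Rightarrow> (real ^ 'n ^ 'n) set" where
  "param_interval_matrix A0 A P = param_matrix A0 A ` P"

definition symmetric_family :: "(real ^ 'n ^ 'n) set \<Rightarrow> bool" where
  "symmetric_family F \<longleftrightarrow> (\<forall>M\<in>F. symmetric_matrix M)"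

definition stable_family :: "(real ^ 'n ^ 'n) set \<Rightarrow> bool" where
  "stable_family F \<longleftrightarrow> (\<forall>M\<in>F. stable_matrix M)"

definition regular_family :: "(real ^ 'n ^ 'n) set \<Rightarrow> bool" where
  "regular_family F \<longleftrightarrow> (\<forall>M\<in>F. invertible M)"

end

theory Submission
  imports Defs
begin

text \<open>
  A real symmetric matrix is stable exactly when it is negative definite, so the theorem says that
  negative definiteness spreads from one member of the family to all others unless a singular
  member lies on the way. The usual argument follows the largest eigenvalue along a segment of the
  box and applies the intermediate value theorem. Here the crossing point is instead found in
  closed form: if \<open>N\<close> is negative definite and \<open>M\<close> is symmetric, the generalised Rayleigh
  quotient \<open>(x \<bullet> M x) / (- (x \<bullet> N x))\<close> attains a maximum \<open>l\<close> on the unit sphere; then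
  \<open>M + l N\<close> is negative semidefinite with a null direction, hence singular
  (lemma \<open>generalized_rayleigh_maximum\<close>).

  This one fact is used twice. For \<open>N = - I\<close> the number \<open>l\<close> is the largest eigenvalue of \<open>M\<close>,
  whence stable symmetric matrices are negative definite. For a stable member \<open>N\<close> and any other
  member \<open>M\<close> of the family, a direction \<open>y\<close> with \<open>y \<bullet> M y \<ge> 0\<close> would force \<open>l \<ge> 0\<close>, and then the
  singular matrix \<open>(M + l N) / (1 + l)\<close> lies on the segment from \<open>N\<close> to \<open>M\<close>. That segment belongs
  to the family, because the box is convex and the parametrisation is affine.
  Conversely, a stable matrix has no eigenvalue \<open>0\<close>.
\<close>

section \<open>Real quadratic forms and complex eigenvalues\<close>

definition negative_definite :: "real ^ 'n ^ 'n \<Rightarrow> bool" where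
  "negative_definite M \<longleftrightarrow> (\<forall>x. x \<noteq> 0 \<longrightarrow> x \<bullet> (M *v x) < 0)"

lemma matrix_eigenvalue_complex_matrix:
  fixes M :: "real ^ 'n ^ 'n"
  assumes "v \<noteq> 0" and "M *v v = r *\<^sub>R v"
  shows "matrix_eigenvalue (complex_matrix M) (complex_of_real r)"
proof -
  define w :: "complex ^ 'n" where "w = (\<chi> i. complex_of_real (v $ i))"
  have "w \<noteq> 0"
    using assms(1) by (auto simp: w_def vec_eq_iff)
  moreover have "complex_matrix M *v w = complex_of_real r *s w"
  proof (subst vec_eq_iff, intro allI)
    fix i
    have "(\<Sum>j\<in>UNIV. M $ i $ j * v $ j) = r * v $ i"
      using arg_cong[OF assms(2), of "\<lambda>u. u $ i"] by (simp add: matrix_vector_mult_def)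
    from arg_cong[OF this, of complex_of_real]
    show "(complex_matrix M *v w) $ i = (complex_of_real r *s w) $ i"
      by (simp add: complex_matrix_def w_def matrix_vector_mult_def)
  qed
  ultimately show ?thesis
    unfolding matrix_eigenvalue_def by blast
qed

lemma stable_matrix_imp_invertible:
  fixes M :: "real ^ 'n ^ 'n"
  assumes "stable_matrix M"
  shows "invertible M"
proof -
  have "v = 0" if "M *v v = 0" for v
  proof (rule ccontr)
    assume "v \<noteq> 0"
    then have "matrix_eigenvalue (complex_matrix M) (complex_of_real 0)"
      using matrix_eigenvalue_complex_matrix[of v M 0] that by simp
    then show False
      using assms unfolding stable_matrix_def by fastforce
  qed
  then show ?thesis
    by (auto simp: invertible_left_inverse matrix_left_invertible_ker)
qed

text \<open>
  Splitting a complex eigenvector into its real and imaginary parts \<open>x\<close> and \<open>y\<close> makes the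
  imaginary part of the eigenvalue cancel in \<open>x \<bullet> M x + y \<bullet> M y\<close>, which leaves the real part times
  a positive number.
\<close>
lemma negative_definite_imp_stable_matrix:
  fixes M :: "real ^ 'n ^ 'n"
  assumes "negative_definite M"
  shows "stable_matrix M"
  unfolding stable_matrix_def
proof (intro allI impI)
  fix c
  assume "matrix_eigenvalue (complex_matrix M) c"
  then obtain v where v: "v \<noteq> 0" "complex_matrix M *v v = c *s v"
    unfolding matrix_eigenvalue_def by blast
  define x where "x = (\<chi> i. Re (v $ i))"
  define y where "y = (\<chi> i. Im (v $ i))"
  have nz: "x \<noteq> 0 \<or> y \<noteq> 0"
    using v(1) by (auto simp: x_def y_def vec_eq_iff complex_eq_iff)
  have comp: "(\<Sum>j\<in>UNIV. complex_of_real (M $ i $ j) * v $ j) = c * v $ i" for i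
    using arg_cong[OF v(2), of "\<lambda>u. u $ i"]
    by (simp add: matrix_vector_mult_def complex_matrix_def)
  have Mx: "M *v x = Re c *\<^sub>R x - Im c *\<^sub>R y"
    using arg_cong[OF comp, of Re] by (simp add: vec_eq_iff matrix_vector_mult_def x_def y_def)
  have My: "M *v y = Re c *\<^sub>R y + Im c *\<^sub>R x"
    using arg_cong[OF comp, of Im] by (simp add: vec_eq_iff matrix_vector_mult_def x_def y_def)
  have "Re c * (x \<bullet> x + y \<bullet> y) = x \<bullet> (M *v x) + y \<bullet> (M *v y)"
    unfolding Mx My by (simp add: inner_commute algebra_simps)
  also have "\<dots> < 0"
  proof -
    have le: "z \<bullet> (M *v z) \<le> 0" for z
      using assms by (cases "z = 0") (auto simp: negative_definite_def intro: less_imp_le)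
    show ?thesis
      using nz assms le[of x] le[of y] unfolding negative_definite_def
      by (metis add_neg_nonpos add_nonpos_neg)
  qed
  finally show "Re c < 0"
    by (metis add_nonneg_nonneg inner_ge_zero linorder_not_less mult_nonneg_nonneg)
qed

section \<open>Symmetric matrices and the generalised Rayleigh quotient\<close>

lemma symmetric_matrix_inner:
  fixes M :: "real ^ 'n ^ 'n"
  assumes "symmetric_matrix M"
  shows "x \<bullet> (M *v y) = y \<bullet> (M *v x)"
  using assms dot_lmul_matrix[of x M y] transpose_matrix_vector[of M x]
  by (simp add: symmetric_matrix_def inner_commute)

lemma symmetric_matrix_add_scaleR:
  assumes "symmetric_matrix M" and "symmetric_matrix N"
  shows "symmetric_matrix (M + l *\<^sub>R N)"
  using assms by (simp add: symmetric_matrix_def transpose_def vec_eq_iff)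

text \<open>
  A null vector maximises the form, so the derivative of the form, which is \<open>2 *\<^sub>R (M *v x)\<close> by
  symmetry, vanishes there.
\<close>
lemma negative_semidefinite_null_vector:
  fixes M :: "real ^ 'n ^ 'n"
  assumes sym: "symmetric_matrix M"
    and nonpos: "\<And>y. y \<bullet> (M *v y) \<le> 0"
    and null: "x \<bullet> (M *v x) = 0"
  shows "M *v x = 0"
proof (rule ccontr)
  assume "M *v x \<noteq> 0"
  define w where "w = M *v x"
  define a where "a = w \<bullet> w"
  define b where "b = w \<bullet> (M *v w)"
  have a: "a > 0"
    using \<open>M *v x \<noteq> 0\<close> by (simp add: a_def w_def)
  have b: "b \<le> 0"
    using nonpos by (simp add: b_def)
  \<comment> \<open>A step along the gradient, short enough for the linear term \<open>2 * t * a\<close> to dominate.\<close>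
  define t where "t = a / (1 - b)"
  have t: "t > 0" "t * (1 - b) = a"
    using a b by (auto simp: t_def)
  have "(x + t *\<^sub>R w) \<bullet> (M *v (x + t *\<^sub>R w)) = 2 * t * a + t * t * b"
    using null symmetric_matrix_inner[OF sym, of x w]
    by (simp add: matrix_vector_right_distrib matrix_vector_mult_scaleR inner_add_left
        inner_add_right a_def b_def w_def algebra_simps)
  also have "\<dots> = t * (a + t)"
    by (simp add: t(2)[symmetric] algebra_simps)
  finally show False
    using nonpos[of "x + t *\<^sub>R w"] t(1) a by (simp add: mult_le_0_iff)
qed

text \<open>
  Dividing by \<open>- (y \<bullet> (N *v y))\<close>, which is positive off the origin, gives a continuous quotient on
  the compact unit sphere. Maximality makes \<open>M + l N\<close> negative semidefinite, and a maximiser is a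
  null vector of its form, hence of the matrix. Moreover \<open>M\<close> is negative definite if and only
  if \<open>l < 0\<close>, which is what both applications exploit.
\<close>
lemma generalized_rayleigh_maximum:
  fixes M N :: "real ^ 'n ^ 'n"
  assumes symM: "symmetric_matrix M" and symN: "symmetric_matrix N"
    and N: "negative_definite N"
  obtains l x where "x \<noteq> 0" and "(M + l *\<^sub>R N) *v x = 0"
    and "\<And>y. y \<bullet> (M *v y) \<le> l * - (y \<bullet> (N *v y))"
proof -
  define S where "S = sphere (0 :: real ^ 'n) 1"
  define R where "R y = (y \<bullet> (M *v y)) / - (y \<bullet> (N *v y))" for y
  have neg: "y \<bullet> (N *v y) < 0" if "y \<noteq> 0" for y
    using N that by (simp add: negative_definite_def)
  have nz: "y \<bullet> (N *v y) \<noteq> 0" if "y \<in> S" for y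
  proof -
    have "y \<noteq> 0"
      using that by (auto simp: S_def)
    then show ?thesis
      using neg[of y] by simp
  qed
  have "compact S"
    by (simp add: S_def)
  moreover have "S \<noteq> {}"
    by (simp add: S_def)
  moreover have "continuous_on S R"
    unfolding R_def
    by (intro continuous_intros matrix_vector_mult_linear_continuous_on)
      (use nz in auto)
  ultimately obtain x where x: "x \<in> S" and max: "\<And>y. y \<in> S \<Longrightarrow> R y \<le> R x"
    using continuous_attains_sup[of S R] by blast
  have x0: "x \<noteq> 0"
    using x by (auto simp: S_def)
  have le: "y \<bullet> (M *v y) \<le> R x * - (y \<bullet> (N *v y))" for y
  proof (cases "y = 0")
    case False
    \<comment> \<open>The quotient is homogeneous of degree zero, so its maximum on the sphere is global.\<close>
    have "R ((1 / norm y) *\<^sub>R y) = R y"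
      using False by (simp add: R_def matrix_vector_mult_scaleR)
    moreover have "(1 / norm y) *\<^sub>R y \<in> S"
      using False by (simp add: S_def)
    ultimately have "R y \<le> R x"
      using max by metis
    then show ?thesis
      using neg[OF False] pos_divide_le_eq[of "- (y \<bullet> (N *v y))" "y \<bullet> (M *v y)" "R x"]
      by (simp add: R_def)
  qed simp
  have form: "y \<bullet> ((M + R x *\<^sub>R N) *v y) = y \<bullet> (M *v y) + R x * (y \<bullet> (N *v y))" for y
    by (simp add: matrix_vector_mult_add_rdistrib inner_add_right
        flip: scaleR_matrix_vector_assoc)
  have "(M + R x *\<^sub>R N) *v x = 0"
  proof (rule negative_semidefinite_null_vector)
    show "symmetric_matrix (M + R x *\<^sub>R N)"
      by (rule symmetric_matrix_add_scaleR[OF symM symN])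
    show "y \<bullet> ((M + R x *\<^sub>R N) *v y) \<le> 0" for y
      using le[of y] by (simp add: form)
    show "x \<bullet> ((M + R x *\<^sub>R N) *v x) = 0"
      unfolding form using neg[OF x0] by (simp add: R_def)
  qed
  then show thesis
    using that x0 le by blast
qed

lemma stable_symmetric_imp_negative_definite:
  fixes M :: "real ^ 'n ^ 'n"
  assumes sym: "symmetric_matrix M" and stable: "stable_matrix M"
  shows "negative_definite M"
proof -
  have mI: "(- mat 1 :: real ^ 'n ^ 'n) *v y = - y" for y
    using matrix_vector_mult_diff_rdistrib[of 0 "mat 1" y] by simp
  have "symmetric_matrix (- mat 1 :: real ^ 'n ^ 'n)"
    by (simp add: symmetric_matrix_def transpose_def mat_def vec_eq_iff)
  moreover have "negative_definite (- mat 1 :: real ^ 'n ^ 'n)"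
    by (simp add: negative_definite_def mI)
  ultimately obtain l x where x: "x \<noteq> 0" "(M + l *\<^sub>R (- mat 1)) *v x = 0"
    and le: "\<And>y. y \<bullet> (M *v y) \<le> l * - (y \<bullet> ((- mat 1) *v y))"
    using generalized_rayleigh_maximum[OF sym] by blast
  have "M *v x + l *\<^sub>R ((- mat 1) *v x) = 0"
    using x(2) by (metis matrix_vector_mult_add_rdistrib scaleR_matrix_vector_assoc)
  then have "M *v x = l *\<^sub>R x"
    by (simp add: mI)
  then have "l < 0"
    using matrix_eigenvalue_complex_matrix[OF x(1)] stable
    unfolding stable_matrix_def by fastforce
  show ?thesis
    unfolding negative_definite_def
  proof (intro allI impI)
    fix y :: "real ^ 'n"
    assume "y \<noteq> 0"
    have "y \<bullet> (M *v y) \<le> l * (y \<bullet> y)"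
      using le[of y] by (simp add: mI)
    also have "\<dots> < 0"
      using \<open>l < 0\<close> \<open>y \<noteq> 0\<close> by (simp add: mult_neg_pos)
    finally show "y \<bullet> (M *v y) < 0" .
  qed
qed

text \<open>
  If \<open>M\<close> is not negative definite, the maximal quotient \<open>l\<close> is nonnegative, and the singular
  matrix \<open>M + l N\<close>, divided by \<open>1 + l\<close>, is a point of the segment.
\<close>
lemma negative_definite_along_regular_segment:
  fixes M N :: "real ^ 'n ^ 'n"
  assumes symM: "symmetric_matrix M" and symN: "symmetric_matrix N"
    and N: "negative_definite N"
    and regular: "\<And>K. K \<in> closed_segment M N \<Longrightarrow> invertible K"
  shows "negative_definite M"
proof (rule ccontr)
  assume "\<not> negative_definite M"
  then obtain y where y: "y \<noteq> 0" "y \<bullet> (M *v y) \<ge> 0"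
    by (auto simp: negative_definite_def not_less)
  obtain l x where x: "x \<noteq> 0" "(M + l *\<^sub>R N) *v x = 0"
    and le: "\<And>y. y \<bullet> (M *v y) \<le> l * - (y \<bullet> (N *v y))"
    using generalized_rayleigh_maximum[OF symM symN N] by blast
  have "- (y \<bullet> (N *v y)) > 0"
    using N y(1) by (simp add: negative_definite_def)
  then have l: "l \<ge> 0"
    using le[of y] y(2) by (metis linorder_not_less mult_neg_pos order_trans)
  define K where "K = (1 / (1 + l)) *\<^sub>R (M + l *\<^sub>R N)"
  have "K = (1 - l / (1 + l)) *\<^sub>R M + (l / (1 + l)) *\<^sub>R N"
  proof -
    have "1 - l / (1 + l) = 1 / (1 + l)"
      using l by (simp add: field_simps)
    then show ?thesis
      by (simp add: K_def scaleR_right_distrib)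
  qed
  then have "K \<in> closed_segment M N"
    unfolding closed_segment_def using l by auto
  then have "invertible K"
    by (rule regular)
  moreover have "K *v x = 0"
    using x(2) by (simp add: K_def flip: scaleR_matrix_vector_assoc)
  ultimately show False
    using x(1) by (auto simp: invertible_left_inverse matrix_left_invertible_ker)
qed

section \<open>Parametric interval matrices\<close>

lemma param_matrix_convex_combination:
  "param_matrix A0 A ((1 - u) *\<^sub>R p + u *\<^sub>R q) =
    (1 - u) *\<^sub>R param_matrix A0 A p + u *\<^sub>R param_matrix A0 A q"
  by (simp add: param_matrix_def scaleR_right_distrib scaleR_left_distrib sum.distrib
      scaleR_sum_right sum_subtractf algebra_simps)

lemma closed_segment_param_interval_matrix:
  assumes "convex P"
    and "M \<in> param_interval_matrix A0 A P" and "N \<in> param_interval_matrix A0 A P"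
  shows "closed_segment M N \<subseteq> param_interval_matrix A0 A P"
proof -
  obtain p q where pq: "p \<in> P" "q \<in> P" "M = param_matrix A0 A p" "N = param_matrix A0 A q"
    using assms(2,3) by (auto simp: param_interval_matrix_def)
  have "closed_segment M N = param_matrix A0 A ` closed_segment p q"
    by (auto simp: pq(3,4) closed_segment_def simp flip: param_matrix_convex_combination)
  then show ?thesis
    using closed_segment_subset[OF pq(1,2) assms(1)] by (auto simp: param_interval_matrix_def)
qed

theorem theorem4p3:
  fixes A0 :: "real ^ 'n ^ 'n"
    and A :: "'k::finite \<Rightarrow> real ^ 'n ^ 'n"
    and pl pu :: "real ^ 'k"
  assumes "\<forall>k. pl $ k \<le> pu $ k"
    and "symmetric_family (param_interval_matrix A0 A (cbox pl pu))"
  shows "stable_family (param_interval_matrix A0 A (cbox pl pu)) \<longleftrightarrow>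
    (\<exists>p\<in>cbox pl pu. stable_matrix (param_matrix A0 A p)) \<and>
    regular_family (param_interval_matrix A0 A (cbox pl pu))"
    (is "stable_family ?F \<longleftrightarrow> ?some \<and> regular_family ?F")
proof
  assume stable: "stable_family ?F"
  have "pl \<in> cbox pl pu"
    using assms(1) by (simp add: mem_box_cart)
  then have ?some
    using stable by (auto simp: stable_family_def param_interval_matrix_def)
  moreover have "regular_family ?F"
    using stable by (simp add: stable_family_def regular_family_def stable_matrix_imp_invertible)
  ultimately show "?some \<and> regular_family ?F" ..
next
  assume *: "?some \<and> regular_family ?F"
  then obtain N where N: "N \<in> ?F" "stable_matrix N"
    by (auto simp: param_interval_matrix_def)
  have sym: "symmetric_matrix M" if "M \<in> ?F" for M
    using assms(2) that by (simp add: symmetric_family_def)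
  show "stable_family ?F"
    unfolding stable_family_def
  proof
    fix M
    assume M: "M \<in> ?F"
    have "invertible K" if "K \<in> closed_segment M N" for K
      using closed_segment_param_interval_matrix[OF convex_box(1) M N(1)] that *
      by (auto simp: regular_family_def)
    then have "negative_definite M"
      using sym M N stable_symmetric_imp_negative_definite
      by (intro negative_definite_along_regular_segment[of M N]) auto
    then show "stable_matrix M"
      by (rule negative_definite_imp_stable_matrix)
  qed
qed

end
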